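(* Let $n\ge2$, let $F^\alpha,F^\beta$ be two Minkowski norms on $\mathbb{R}^n$ with indicatrices $\Sigma^\alpha,\Sigma^\beta$, and let $A\ne B$ be points of $\mathbb{R}^n$. Let $p$ be an optimal tack point for the travel from $A$ to $B$, and consider the multi-convex indicatrix $\Sigma$ formed by (the outermost parts of) $\Sigma^\alpha$ and $\Sigma^\beta$. Then the piecewise segment joining $A$, $p$ and $B$ is the unique curve from $A$ to $B$ that is time-minimizing for the travel with velocity $\Sigma$ and satisfies the following restrictions: (I) only one tack point $p'$ is allowed; (II) one must travel from $A$ to $p'$ with velocity $\Sigma^\alpha$, and from $p'$ to $B$ with velocity $\Sigma^\beta$.
   Context: A Minkowski norm (constant Finsler metric) on $\mathbb{R}^n$ is a continuous function $F:\mathbb{R}^n\to[0,\infty)$, positive and smooth away from $0$, positively homogeneous of degree 1 (not necessarily symmetric), whose indicatrix $\{v:F(v)=1\}$ is strongly convex (the Hessian of $\frac12F^2$ is positive definite at every $v\ne0$). An optimal tack point is a point $p\in\mathbb{R}^n$ where $\mathcal{T}(p)=F^\alpha(p-A)+F^\beta(B-p)$ attains its global minimum over $\mathbb{R}^n$. $\Sigma$ is the topological sphere which in each direction from the origin consists of the outermost of the two points of $\Sigma^\alpha$ and $\Sigma^\beta$ (i.e. the boundary of the union of the two closed unit balls), assumed to be multi-convex, that is, a finite union of compact $C^1$ patches of indicatrices of strictly convex norms (here $\Sigma^\alpha$ and $\Sigma^\beta$). The associated norm is $\|v\|_\Sigma=$ the unique positive number with $v/\|v\|_\Sigma\in\Sigma$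 for $v\neq0$, $\|0\|_\Sigma=0$; thus $\|v\|_\Sigma=\min\{F^\alpha(v),F^\beta(v)\}$. The travel time with velocity $\Sigma$ of a (regular, piecewise smooth) curve $\gamma:[a,b]\to\mathbb{R}^n$ is $\int_a^b\|\gamma'(s)\|_\Sigma\,ds$, and $\gamma$ from $A$ to $B$ is time-minimizing for the travel with velocity $\Sigma$ if no piecewise smooth curve from $A$ to $B$ has smaller travel time. Curves are identified up to reparametrization. A curve that is time-minimizing with velocity $\Sigma$ satisfies (I) and (II) when it is the concatenation of a straight segment from $A$ to some point $p'$ and a straight segment from $p'$ to $B$ (either may be degenerate, and the curve need not actually break at $p'$), where the first is traveled with velocity in $\Sigma\cap\Sigma^\alpha$ and the second with velocity in $\Sigma\cap\Sigma^\beta$. *)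

theory Defs
  imports "HOL-Analysis.Analysis"
begin

section \<open>Smooth maps\<close>

text \<open>\<open>C_k_on k S f\<close>: \<open>f\<close> is of class \<open>C\<^sup>k\<close> on the set \<open>S\<close>, which is meant to be open
  (derivatives are taken in the full space).\<close>

primrec C_k_on ::
  "nat \<Rightarrow> 'a::real_normed_vector set \<Rightarrow> ('a \<Rightarrow> 'b::real_normed_vector) \<Rightarrow> bool" where
  "C_k_on 0 S f \<longleftrightarrow> continuous_on S f"
| "C_k_on (Suc k) S f \<longleftrightarrow> (\<forall>x\<in>S. f differentiable (at x)) \<and>
     (\<forall>v. C_k_on k S (\<lambda>x. frechet_derivative f (at x) v))"

definition smooth_on ::
  "'a::real_normed_vector set \<Rightarrow> ('a \<Rightarrow> 'b::real_normed_vector) \<Rightarrow> bool" where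
  "smooth_on S f \<longleftrightarrow> (\<forall>k. C_k_on k S f)"

text \<open>\<open>hessian f x u w\<close> is the second derivative \<open>D\<^sup>2f(x)(u, w)\<close>.\<close>

definition hessian :: "('a::real_normed_vector \<Rightarrow> real) \<Rightarrow> 'a \<Rightarrow> 'a \<Rightarrow> 'a \<Rightarrow> real" where
  "hessian f x u w = frechet_derivative (\<lambda>y. frechet_derivative f (at y) u) (at x) w"

section \<open>Minkowski norms and indicatrices\<close>

definition minkowski_norm :: "('a::euclidean_space \<Rightarrow> real) \<Rightarrow> bool" where
  "minkowski_norm F \<longleftrightarrow>
     continuous_on UNIV F \<and>
     (\<forall>v. 0 \<le> F v) \<and>
     (\<forall>v. v \<noteq> 0 \<longrightarrow> 0 < F v) \<and>
     smooth_on (- {0}) F \<and>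
     (\<forall>c>0. \<forall>v. F (c *\<^sub>R v) = c * F v) \<and>
     (\<forall>v. v \<noteq> 0 \<longrightarrow> (\<forall>u. u \<noteq> 0 \<longrightarrow> 0 < hessian (\<lambda>y. (F y)\<^sup>2 / 2) v u u))"

definition indicatrix :: "('a \<Rightarrow> real) \<Rightarrow> 'a set" where
  "indicatrix F = {v. F v = 1}"

text \<open>The points of the two indicatrices that are outermost on their ray from the origin.\<close>

definition outer_indicatrix ::
  "('a::euclidean_space \<Rightarrow> real) \<Rightarrow> ('a \<Rightarrow> real) \<Rightarrow> 'a set" where
  "outer_indicatrix F G =
     {v \<in> indicatrix F \<union> indicatrix G.
        \<forall>c>0. c *\<^sub>R v \<in> indicatrix F \<union> indicatrix G \<longrightarrow> c \<le> 1}"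

text \<open>Norms in the following definition need be neither symmetric nor smooth.\<close>

definition strictly_convex_norm :: "('a::euclidean_space \<Rightarrow> real) \<Rightarrow> bool" where
  "strictly_convex_norm N \<longleftrightarrow>
     continuous_on UNIV N \<and>
     (\<forall>v. 0 \<le> N v) \<and>
     (\<forall>v. v \<noteq> 0 \<longrightarrow> 0 < N v) \<and>
     (\<forall>c>0. \<forall>v. N (c *\<^sub>R v) = c * N v) \<and>
     (\<forall>v\<in>indicatrix N. \<forall>w\<in>indicatrix N. v \<noteq> w \<longrightarrow>
        (\<forall>t. 0 < t \<and> t < 1 \<longrightarrow> N ((1 - t) *\<^sub>R v + t *\<^sub>R w) < 1))"

text \<open>A compact piece of the indicatrix of \<open>N\<close> near which the indicatrix is a \<open>C\<^sup>1\<close>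
  hypersurface (by homogeneity the differential of \<open>N\<close> does not vanish there). No
  regularity of the boundary of the piece is required.\<close>

definition compact_C1_patch :: "('a::euclidean_space \<Rightarrow> real) \<Rightarrow> 'a set \<Rightarrow> bool" where
  "compact_C1_patch N P \<longleftrightarrow>
     compact P \<and> P \<subseteq> indicatrix N \<and> (\<exists>U. open U \<and> P \<subseteq> U \<and> C_k_on 1 U N)"

text \<open>\<open>multi_convex \<N> S\<close>: the set \<open>S\<close> is multi-convex, with patches taken from the
  indicatrices of the norms in \<open>\<N>\<close>.\<close>

definition multi_convex :: "('a::euclidean_space \<Rightarrow> real) set \<Rightarrow> 'a set \<Rightarrow> bool" where
  "multi_convex \<N> S \<longleftrightarrow>
     (\<exists>\<P>. finite \<P> \<and> S = \<Union>\<P> \<and>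
        (\<forall>P\<in>\<P>. \<exists>N\<in>\<N>. strictly_convex_norm N \<and> compact_C1_patch N P))"

text \<open>The norm associated with \<open>S\<close>; the description is proper when \<open>S\<close> meets every ray from
  the origin in exactly one point, as \<open>outer_indicatrix\<close> does.\<close>

definition radial_norm :: "'a::euclidean_space set \<Rightarrow> 'a \<Rightarrow> real" where
  "radial_norm S v = (if v = 0 then 0 else (THE r. 0 < r \<and> v /\<^sub>R r \<in> S))"

section \<open>Curves and travel time\<close>

text \<open>A curve is given by a function \<open>\<gamma>\<close> and its parameter interval \<open>{a..b}\<close>. Smoothness up to
  the end points of a piece means that the piece extends smoothly to a neighbourhood.\<close>

definition regular_smooth_piece ::
  "(real \<Rightarrow> 'a::euclidean_space) \<Rightarrow> real \<Rightarrow> real \<Rightarrow> bool" where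
  "regular_smooth_piece \<gamma> c d \<longleftrightarrow>
     (\<exists>g U. open U \<and> {c..d} \<subseteq> U \<and> smooth_on U g \<and>
        (\<forall>t\<in>{c..d}. \<gamma> t = g t \<and> vector_derivative g (at t) \<noteq> 0))"

definition piecewise_smooth_curve ::
  "(real \<Rightarrow> 'a::euclidean_space) \<Rightarrow> real \<Rightarrow> real \<Rightarrow> bool" where
  "piecewise_smooth_curve \<gamma> a b \<longleftrightarrow> a < b \<and>
     (\<exists>(m::nat) \<tau>. \<tau> 0 = a \<and> \<tau> m = b \<and>
        (\<forall>i<m. \<tau> i < \<tau> (Suc i) \<and> regular_smooth_piece \<gamma> (\<tau> i) (\<tau> (Suc i))))"

definition curve_from_to ::
  "'a::euclidean_space \<Rightarrow> 'a \<Rightarrow> (real \<Rightarrow> 'a) \<Rightarrow> real \<Rightarrow> real \<Rightarrow> bool" where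
  "curve_from_to A B \<gamma> a b \<longleftrightarrow> piecewise_smooth_curve \<gamma> a b \<and> \<gamma> a = A \<and> \<gamma> b = B"

text \<open>The derivative is unspecified at the finitely many break points, which does not affect
  the integral.\<close>

definition travel_time ::
  "'a::euclidean_space set \<Rightarrow> (real \<Rightarrow> 'a) \<Rightarrow> real \<Rightarrow> real \<Rightarrow> real" where
  "travel_time S \<gamma> a b = integral {a..b} (\<lambda>s. radial_norm S (vector_derivative \<gamma> (at s)))"

definition time_minimizing ::
  "'a::euclidean_space set \<Rightarrow> 'a \<Rightarrow> 'a \<Rightarrow> (real \<Rightarrow> 'a) \<Rightarrow> real \<Rightarrow> real \<Rightarrow> bool" where
  "time_minimizing S A B \<gamma> a b \<longleftrightarrow>
     curve_from_to A B \<gamma> a b \<and>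
     (\<forall>\<delta> c d. curve_from_to A B \<delta> c d \<longrightarrow> travel_time S \<gamma> a b \<le> travel_time S \<delta> c d)"

text \<open>Oriented reparametrization, by an increasing homeomorphism of the parameter intervals.
  Between regular piecewise smooth curves such a homeomorphism is automatically piecewise smooth
  with positive derivative on each piece.\<close>

definition reparametrization ::
  "(real \<Rightarrow> 'a::euclidean_space) \<Rightarrow> real \<Rightarrow> real \<Rightarrow> (real \<Rightarrow> 'a) \<Rightarrow> real \<Rightarrow> real \<Rightarrow> bool" where
  "reparametrization \<gamma> a b \<delta> c d \<longleftrightarrow>
     (\<exists>\<phi>. continuous_on {a..b} \<phi> \<and> strict_mono_on {a..b} \<phi> \<and> \<phi> ` {a..b} = {c..d} \<and>
        (\<forall>t\<in>{a..b}. \<gamma> t = \<delta> (\<phi> t)))"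

section \<open>Tacking\<close>

definition optimal_tack_point ::
  "('a::euclidean_space \<Rightarrow> real) \<Rightarrow> ('a \<Rightarrow> real) \<Rightarrow> 'a \<Rightarrow> 'a \<Rightarrow> 'a \<Rightarrow> bool" where
  "optimal_tack_point F G A B p \<longleftrightarrow> (\<forall>q. F (p - A) + G (B - p) \<le> F (q - A) + G (B - q))"

text \<open>\<open>\<gamma>\<close> restricted to \<open>{c..d}\<close> runs once, in the positive direction, along the straight
  segment from \<open>x\<close> to \<open>y\<close>. A degenerate segment takes up a single parameter value, since
  regular curves cannot stay at rest.\<close>

definition traverses_segment ::
  "(real \<Rightarrow> 'a::euclidean_space) \<Rightarrow> real \<Rightarrow> real \<Rightarrow> 'a \<Rightarrow> 'a \<Rightarrow> bool" where
  "traverses_segment \<gamma> c d x y \<longleftrightarrow>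
     (if x = y then c = d \<and> \<gamma> c = x
      else c < d \<and> (\<exists>h. strict_mono_on {c..d} h \<and> h c = 0 \<and> h d = 1 \<and>
             (\<forall>t\<in>{c..d}. \<gamma> t = x + h t *\<^sub>R (y - x))))"

text \<open>The velocity vector in the direction of \<open>v \<noteq> 0\<close> for the travel with velocity \<open>S\<close>.\<close>

definition velocity :: "'a::euclidean_space set \<Rightarrow> 'a \<Rightarrow> 'a" where
  "velocity S v = v /\<^sub>R radial_norm S v"

text \<open>A single tack at \<open>p'\<close> (possibly degenerate), travelling first with velocity in the
  indicatrix of \<open>F\<close> and then with velocity in that of \<open>G\<close>; \<open>S\<close> is the velocity set.\<close>

definition single_tack_curve ::
  "'a::euclidean_space set \<Rightarrow> ('a \<Rightarrow> real) \<Rightarrow> ('a \<Rightarrow> real) \<Rightarrow> 'a \<Rightarrow> 'a \<Rightarrow>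
     (real \<Rightarrow> 'a) \<Rightarrow> real \<Rightarrow> real \<Rightarrow> bool" where
  "single_tack_curve S F G A B \<gamma> a b \<longleftrightarrow>
     (\<exists>p' c. a \<le> c \<and> c \<le> b \<and>
        traverses_segment \<gamma> a c A p' \<and> traverses_segment \<gamma> c b p' B \<and>
        (p' \<noteq> A \<longrightarrow> velocity S (p' - A) \<in> S \<inter> indicatrix F) \<and>
        (p' \<noteq> B \<longrightarrow> velocity S (B - p') \<in> S \<inter> indicatrix G))"

text \<open>The piecewise segment joining \<open>A\<close>, \<open>p\<close> and \<open>B\<close>, parametrized on \<open>{0..1}\<close>; a degenerate
  segment is left out, to keep the curve regular.\<close>

definition piecewise_segment ::
  "'a::euclidean_space \<Rightarrow> 'a \<Rightarrow> 'a \<Rightarrow> real \<Rightarrow> 'a" where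
  "piecewise_segment A p B =
     (if p = A \<or> p = B then linepath A B else linepath A p +++ linepath p B)"

end

theory Submission
  imports Defs
begin

text \<open>Existence is a calibration argument. At an optimal tack point \<open>p \<noteq> B\<close> the differential
  \<open>l\<close> of \<open>F\<^sup>\<beta>\<close> at \<open>B - p\<close> is bounded by both norms, hence by the norm \<open>min F\<^sup>\<alpha> F\<^sup>\<beta>\<close> of the
  outer indicatrix, and takes the value \<open>F\<^sup>\<alpha>(p - A) + F\<^sup>\<beta>(B - p)\<close> at \<open>B - A\<close> (for \<open>p = B\<close>
  exchange the norms). Integrating \<open>l\<close> along a curve bounds its travel time from below by this
  value, and the broken line through \<open>p\<close> attains it.

  For uniqueness, the tack point \<open>p'\<close> of a minimizing single-tack curve is itself optimal. Comparing
  with the midpoint of \<open>p\<close> and \<open>p'\<close>, strict convexity leaves only \<open>p = p'\<close> or both points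
  on the segment from \<open>A\<close> to \<open>B\<close>; either way the two curves have the same oriented trace.\<close>

section \<open>Minkowski norms\<close>

lemma minkowski_norm_scale:
  assumes "minkowski_norm F" "0 \<le> c"
  shows "F (c *\<^sub>R v) = c * F v"
proof (cases "c = 0")
  case True
  \<comment> \<open>Homogeneity is given for positive factors only. The factor 2 at the origin gives
    \<open>F 0 = 2 * F 0\<close>, hence \<open>F 0 = 0\<close>, which settles the factor 0.\<close>
  have "F ((2::real) *\<^sub>R 0) = 2 * F 0"
    using assms(1) unfolding minkowski_norm_def by (metis zero_less_numeral)
  then show ?thesis
    using True by simp
next
  case False
  then show ?thesis
    using assms unfolding minkowski_norm_def by simp
qed

lemma minkowski_norm_zero: "minkowski_norm F \<Longrightarrow> F 0 = 0"
  using minkowski_norm_scale[of F 0 0] by simp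

lemma minkowski_norm_pos: "minkowski_norm F \<Longrightarrow> v \<noteq> 0 \<Longrightarrow> 0 < F v"
  unfolding minkowski_norm_def by blast

lemma minkowski_norm_nonneg: "minkowski_norm F \<Longrightarrow> 0 \<le> F v"
  unfolding minkowski_norm_def by blast

lemma minkowski_norm_continuous: "minkowski_norm F \<Longrightarrow> continuous_on UNIV F"
  unfolding minkowski_norm_def by blast

lemma minkowski_norm_differentiable:
  assumes "minkowski_norm F" "v \<noteq> 0"
  shows "F differentiable (at v)"
proof -
  have "C_k_on 1 (- {0}) F"
    using assms(1) unfolding minkowski_norm_def smooth_on_def by blast
  then show ?thesis
    using assms(2) by simp
qed

lemma minkowski_norm_differentiable_twice:
  assumes "minkowski_norm F" "v \<noteq> 0"
  shows "(\<lambda>y. frechet_derivative F (at y) u) differentiable (at v)"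
proof -
  have "C_k_on (Suc (Suc 0)) (- {0}) F"
    using assms(1) unfolding minkowski_norm_def smooth_on_def by blast
  then show ?thesis
    using assms(2) by simp
qed

section \<open>Directional derivatives and their one-sided bounds\<close>

lemma DERIV_along_line:
  fixes f :: "'a::real_normed_vector \<Rightarrow> real"
  assumes "f differentiable (at (x + t *\<^sub>R w))"
  shows "((\<lambda>s. f (x + s *\<^sub>R w)) has_real_derivative
    frechet_derivative f (at (x + t *\<^sub>R w)) w) (at t)"
proof -
  let ?D = "frechet_derivative f (at (x + t *\<^sub>R w))"
  have D: "(f has_derivative ?D) (at (x + t *\<^sub>R w))"
    using assms by (simp add: frechet_derivative_works)
  have "((\<lambda>s. x + s *\<^sub>R w) has_derivative (\<lambda>h. h *\<^sub>R w)) (at t)"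
    by (auto intro!: derivative_eq_intros)
  from diff_chain_at[OF this D]
  have "((\<lambda>s. f (x + s *\<^sub>R w)) has_derivative (\<lambda>h. ?D (h *\<^sub>R w))) (at t)"
    by (simp add: o_def)
  moreover have "(\<lambda>h. ?D (h *\<^sub>R w)) = (*) (?D w)"
    using linear_cmul[OF has_derivative_linear[OF D]] by (auto simp: mult.commute)
  ultimately show ?thesis
    by (simp add: has_field_derivative_def)
qed

text \<open>A bound on the difference quotients for small positive steps passes to the limit from
  the right. In this way inequalities between norms become bounds on a differential.\<close>

lemma frechet_derivative_le:
  fixes f :: "'a::real_normed_vector \<Rightarrow> real"
  assumes "f differentiable (at w)"
    and "\<And>e. 0 < e \<Longrightarrow> e < 1 \<Longrightarrow> f (w + e *\<^sub>R x) \<le> f w + e * c"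
  shows "frechet_derivative f (at w) x \<le> c"
proof -
  have "((\<lambda>s. f (w + s *\<^sub>R x)) has_real_derivative frechet_derivative f (at w) x) (at 0)"
    using DERIV_along_line[of f w 0 x] assms(1) by simp
  then have "((\<lambda>h. (f (w + h *\<^sub>R x) - f w) / h) \<longlongrightarrow> frechet_derivative f (at w) x) (at_right 0)"
    unfolding DERIV_def by (auto intro: tendsto_within_subset)
  moreover have "\<forall>\<^sub>F h in at_right 0. (f (w + h *\<^sub>R x) - f w) / h \<le> c"
    using eventually_at_right_less[of 0] eventually_at_right_real[OF zero_less_one]
    by eventually_elim (use assms(2) in \<open>force simp: field_simps\<close>)
  ultimately show ?thesis
    by (rule tendsto_upperbound) simp
qed

lemma frechet_derivative_ge:
  fixes f :: "'a::real_normed_vector \<Rightarrow> real"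
  assumes f: "f differentiable (at w)"
    and "\<And>e. 0 < e \<Longrightarrow> e < 1 \<Longrightarrow> f w + e * c \<le> f (w + e *\<^sub>R x)"
  shows "c \<le> frechet_derivative f (at w) x"
proof -
  have "frechet_derivative (\<lambda>y. - f y) (at w) x \<le> - c"
  proof (rule frechet_derivative_le)
    show "- f (w + e *\<^sub>R x) \<le> - f w + e * - c" if "0 < e" "e < 1" for e
      using assms(2)[OF that] by simp
  qed (use f in simp)
  moreover have "((\<lambda>y. - f y) has_derivative (\<lambda>h. - frechet_derivative f (at w) h)) (at w)"
    using f by (intro has_derivative_minus) (simp add: frechet_derivative_works)
  then have "frechet_derivative (\<lambda>y. - f y) (at w) x = - frechet_derivative f (at w) x"
    by (metis frechet_derivative_at)
  ultimately show ?thesis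
    by simp
qed

section \<open>Strict convexity and the triangle inequality\<close>

lemma less_left_endpoint_if_second_deriv_pos:
  fixes g g' g'' :: "real \<Rightarrow> real"
  assumes g: "\<And>t. 0 \<le> t \<Longrightarrow> t \<le> 1 \<Longrightarrow> (g has_real_derivative g' t) (at t)"
    and g': "\<And>t. 0 \<le> t \<Longrightarrow> t \<le> 1 \<Longrightarrow> (g' has_real_derivative g'' t) (at t)"
    and pos: "\<And>t. 0 \<le> t \<Longrightarrow> t \<le> 1 \<Longrightarrow> 0 < g'' t"
    and le: "g 1 \<le> g 0" and t: "0 < t" "t < 1"
  shows "g t < g 0"
proof (rule ccontr)
  assume "\<not> g t < g 0"
  then have ge: "g 0 \<le> g t" by simp
  \<comment> \<open>If \<open>g\<close> is not below \<open>g 0\<close> at \<open>t\<close> but has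
    come back to at most \<open>g 0\<close> at 1, its slope is nonnegative somewhere before
    \<open>t\<close> and nonpositive somewhere after, although \<open>g'\<close> is strictly
    increasing.\<close>
  obtain r where r: "0 < r" "r < t" "g t - g 0 = (t - 0) * g' r"
    using MVT2[of 0 t g g'] g t by auto
  obtain s where s: "t < s" "s < 1" "g 1 - g t = (1 - t) * g' s"
    using MVT2[of t 1 g g'] g t by auto
  have "0 \<le> g' r"
    using r ge t by (metis diff_ge_0_iff_ge diff_zero zero_le_mult_iff not_less)
  moreover have "(1 - t) * g' s \<le> 0"
    using s ge le by linarith
  then have "g' s \<le> 0"
    using t by (simp add: mult_le_0_iff)
  moreover obtain q where "r < q" "q < s" "g' s - g' r = (s - r) * g'' q"
    using MVT2[of r s g' g''] g' r s t by auto
  moreover from this have "0 < (s - r) * g'' q"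
    using pos[of q] r s by (intro mult_pos_pos) auto
  ultimately show False
    by linarith
qed

text \<open>The half square of \<open>F\<close>, restricted to the segment, has a positive second
  derivative. The Hessian is controlled only away from 0, so the segment must avoid the
  origin.\<close>

lemma minkowski_norm_less_on_segment:
  assumes F: "minkowski_norm F"
    and xy: "x \<noteq> y" "F y \<le> F x"
    and nz: "\<And>t. 0 \<le> t \<Longrightarrow> t \<le> 1 \<Longrightarrow> x + t *\<^sub>R (y - x) \<noteq> 0"
    and t: "0 < t" "t < 1"
  shows "F (x + t *\<^sub>R (y - x)) < F x"
proof -
  define f where "f = (\<lambda>y. (F y)\<^sup>2 / 2)"
  define w where "w = y - x"
  have Df: "(f has_derivative (\<lambda>h. F z * frechet_derivative F (at z) h)) (at z)" if "z \<noteq> 0" for z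
  proof -
    have "(F has_derivative frechet_derivative F (at z)) (at z)"
      using minkowski_norm_differentiable[OF F that] by (simp add: frechet_derivative_works)
    then show ?thesis
      unfolding f_def power2_eq_square by (auto intro!: derivative_eq_intros)
  qed
  then have f: "f differentiable (at z)" if "z \<noteq> 0" for z
    using that by (auto simp: differentiable_def)
  \<comment> \<open>On the open set \<open>- {0}\<close> this directional derivative coincides with
    a product of differentiable functions, so it is differentiable there as well.\<close>
  have f': "(\<lambda>y. frechet_derivative f (at y) w) differentiable (at z)" if "z \<noteq> 0" for z
  proof -
    have "(\<lambda>y. F y * frechet_derivative F (at y) w) differentiable (at z)"
      using minkowski_norm_differentiable[OF F that] minkowski_norm_differentiable_twice[OF F that]
      by (rule differentiable_mult)
    then obtain D where D: "((\<lambda>y. F y * frechet_derivative F (at y) w) has_derivative D) (at z)"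
      by (auto simp: differentiable_def)
    have "((\<lambda>y. frechet_derivative f (at y) w) has_derivative D) (at z)"
      by (rule has_derivative_transform_within_open[OF D, of "- {0}"])
        (use that frechet_derivative_at[OF Df] in \<open>auto simp: fun_eq_iff\<close>)
    then show ?thesis
      by (auto simp: differentiable_def)
  qed
  have "f (x + t *\<^sub>R w) < f (x + 0 *\<^sub>R w)"
  proof (rule less_left_endpoint_if_second_deriv_pos[where g = "\<lambda>s. f (x + s *\<^sub>R w)"
        and g' = "\<lambda>s. frechet_derivative f (at (x + s *\<^sub>R w)) w"
        and g'' = "\<lambda>s. hessian f (x + s *\<^sub>R w) w w"])
    show "0 < hessian f (x + s *\<^sub>R w) w w" if "0 \<le> s" "s \<le> 1" for s
      using F nz[OF that] xy(1) unfolding minkowski_norm_def f_def w_def by simp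
    show "f (x + 1 *\<^sub>R w) \<le> f (x + 0 *\<^sub>R w)"
      using xy(2) minkowski_norm_nonneg[OF F] by (simp add: f_def w_def power_mono)
  qed (use t nz in \<open>auto simp: hessian_def w_def[symmetric] intro!: DERIV_along_line[OF f]
      DERIV_along_line[OF f']\<close>)
  then show ?thesis
    using minkowski_norm_nonneg[OF F] by (auto simp: f_def w_def intro: power2_less_imp_less)
qed

text \<open>Opposite vectors cancel in part. For independent vectors, \<open>u + v\<close> is a
  positive multiple of a point strictly between the unit vectors along \<open>u\<close> and
  \<open>v\<close>, where strict convexity applies. Only vectors on a common ray give
  equality.\<close>

lemma minkowski_norm_add_less:
  assumes F: "minkowski_norm F"
    and u: "u \<noteq> 0" and npar: "\<And>c. 0 \<le> c \<Longrightarrow> v \<noteq> c *\<^sub>R u"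
  shows "F (u + v) < F u + F v"
proof -
  have v: "v \<noteq> 0"
    using npar[of 0] by auto
  have pos: "0 < F u" "0 < F v"
    using minkowski_norm_pos[OF F] u v by auto
  show ?thesis
  proof (cases "\<exists>c. v = c *\<^sub>R u")
    case True
    then obtain c where c: "v = c *\<^sub>R u" by blast
    with npar[of c] have "c < 0" by linarith
    show ?thesis
    \<comment> \<open>Factors taken out of \<open>F\<close> must be nonnegative. So the sum is
      written as a multiple of \<open>u\<close> or of \<open>v\<close>, whichever survives the
      cancellation, with a factor that is at least 0 and below 1.\<close>
    proof (cases "c \<ge> -1")
      case True
      have "F (u + v) = F ((1 + c) *\<^sub>R u)"
        by (simp add: c algebra_simps)
      also have "\<dots> = (1 + c) * F u"
        using True by (intro minkowski_norm_scale[OF F]) auto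
      also have "\<dots> < F u"
        using \<open>c < 0\<close> pos by (simp add: algebra_simps mult_neg_pos)
      finally show ?thesis using pos by simp
    next
      case False
      then have "u + v = (1 + 1 / c) *\<^sub>R v"
        using \<open>c < 0\<close> by (simp add: c algebra_simps)
      then have "F (u + v) = (1 + 1 / c) * F v"
        using False by (simp add: minkowski_norm_scale[OF F] field_simps)
      also have "\<dots> < F v"
        using \<open>c < 0\<close> pos by (simp add: field_simps)
      finally show ?thesis using pos by simp
    qed
  next
    case False
    define x where "x = (1 / F u) *\<^sub>R u"
    define y where "y = (1 / F v) *\<^sub>R v"
    \<comment> \<open>With this weight the point of the chord from \<open>x\<close> to
      \<open>y\<close> is \<open>u + v\<close> divided by \<open>F u + F v\<close>.\<close>
    define t where "t = F v / (F u + F v)"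
    \<comment> \<open>Linear independence gives both that the chord avoids the origin and that its
      ends differ.\<close>
    have comb: "a *\<^sub>R u + b *\<^sub>R v \<noteq> 0" if "a \<noteq> 0 \<or> b \<noteq> 0" for a b
    proof
      assume eq: "a *\<^sub>R u + b *\<^sub>R v = 0"
      then have "b \<noteq> 0"
        using that u by auto
      have "v = (1 / b) *\<^sub>R (b *\<^sub>R v)"
        using \<open>b \<noteq> 0\<close> by simp
      also have "b *\<^sub>R v = (- a) *\<^sub>R u"
        using eq by (simp add: eq_neg_iff_add_eq_0 add.commute)
      finally have "v = (1 / b * - a) *\<^sub>R u"
        by (simp only: scaleR_scaleR)
      with False show False by blast
    qed
    have xy: "x + s *\<^sub>R (y - x) = ((1 - s) / F u) *\<^sub>R u + (s / F v) *\<^sub>R v" for s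
      by (simp add: x_def y_def algebra_simps diff_divide_distrib)
    have "F (x + t *\<^sub>R (y - x)) < F x"
    proof (rule minkowski_norm_less_on_segment[OF F])
      show "x + s *\<^sub>R (y - x) \<noteq> 0" for s
        unfolding xy using pos by (intro comb) auto
      show "x \<noteq> y"
        using comb[of "1 / F u" "- 1 / F v"] pos by (auto simp: x_def y_def)
      show "F y \<le> F x"
        using pos by (simp add: x_def y_def minkowski_norm_scale[OF F])
    qed (use pos in \<open>auto simp: t_def\<close>)
    moreover have "(1 - t) / F u = 1 / (F u + F v)" "t / F v = 1 / (F u + F v)"
      using pos by (auto simp: t_def diff_divide_eq_iff)
    then have "x + t *\<^sub>R (y - x) = (1 / (F u + F v)) *\<^sub>R (u + v)"
      unfolding xy by (simp add: scaleR_add_right)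
    then have "F (x + t *\<^sub>R (y - x)) = F (u + v) / (F u + F v)"
      using pos by (simp add: minkowski_norm_scale[OF F] del: scaleR_add_right)
    moreover have "F x = 1"
      using pos by (simp add: x_def minkowski_norm_scale[OF F])
    ultimately show ?thesis
      using pos by simp
  qed
qed

lemma minkowski_norm_add_le:
  assumes F: "minkowski_norm F"
  shows "F (u + v) \<le> F u + F v"
proof (cases "u = 0 \<or> (\<exists>c\<ge>0. v = c *\<^sub>R u)")
  case True
  then show ?thesis
  proof
    assume "\<exists>c\<ge>0. v = c *\<^sub>R u"
    then obtain c where c: "0 \<le> c" "v = c *\<^sub>R u" by blast
    then have "u + v = (1 + c) *\<^sub>R u"
      by (simp add: algebra_simps)
    then show ?thesis
      using c minkowski_norm_scale[OF F, of "1 + c" u]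
      by (simp add: minkowski_norm_scale[OF F] distrib_right)
  qed (simp add: minkowski_norm_zero[OF F])
next
  case False
  then show ?thesis
    using minkowski_norm_add_less[OF F, of u v] by force
qed

section \<open>The norm of the outer indicatrix\<close>

text \<open>The ray through \<open>v\<close> meets the two indicatrices at \<open>v\<close> divided
  by \<open>F v\<close> and by \<open>G v\<close>. The outermost of these points has the smaller
  divisor.\<close>

lemma radial_norm_outer_indicatrix:
  assumes F: "minkowski_norm F" and G: "minkowski_norm G"
  shows "radial_norm (outer_indicatrix F G) v = min (F v) (G v)"
proof (cases "v = 0")
  case True
  then show ?thesis
    by (simp add: radial_norm_def minkowski_norm_zero[OF F] minkowski_norm_zero[OF G])
next
  case False
  have pos: "0 < F v" "0 < G v"
    using minkowski_norm_pos[OF F False] minkowski_norm_pos[OF G False] by auto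
  have ind: "c *\<^sub>R v \<in> indicatrix F \<union> indicatrix G \<longleftrightarrow> c = 1 / F v \<or> c = 1 / G v" if "0 < c" for c
    using that pos
    by (auto simp: indicatrix_def minkowski_norm_scale[OF F] minkowski_norm_scale[OF G] field_simps)
  have "(0 < r \<and> v /\<^sub>R r \<in> outer_indicatrix F G) \<longleftrightarrow> r = min (F v) (G v)" for r
  proof
    assume r: "0 < r \<and> v /\<^sub>R r \<in> outer_indicatrix F G"
    \<comment> \<open>Outermost is defined relative to \<open>v /\<^sub>R r\<close>, so the point
      \<open>c *\<^sub>R v\<close> of the ray corresponds to the factor
      \<open>c * r\<close>.\<close>
    then have le: "c \<le> 1 / r" if "0 < c" "c *\<^sub>R v \<in> indicatrix F \<union> indicatrix G" for c
      using that unfolding outer_indicatrix_def by (auto dest!: spec[of _ "c * r"] simp: field_simps)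
    have "(1 / r) *\<^sub>R v \<in> indicatrix F \<union> indicatrix G"
      using r by (auto simp: outer_indicatrix_def inverse_eq_divide)
    then have "r = F v \<or> r = G v"
      using ind[of "1 / r"] r by auto
    moreover have "r \<le> F v" "r \<le> G v"
      using le[of "1 / F v"] le[of "1 / G v"] ind[of "1 / F v"] ind[of "1 / G v"] pos r
      by (auto simp: field_simps)
    ultimately show "r = min (F v) (G v)" by auto
  next
    assume r: "r = min (F v) (G v)"
    then have "0 < r" "r \<le> F v" "r \<le> G v" "r = F v \<or> r = G v"
      using pos by (auto simp: min_def)
    moreover from this have "v /\<^sub>R r \<in> indicatrix F \<union> indicatrix G"
      using ind[of "1 / r"] by (auto simp: inverse_eq_divide)
    moreover have "c \<le> 1" if "0 < c" "c *\<^sub>R (v /\<^sub>R r) \<in> indicatrix F \<union> indicatrix G" for c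
    proof -
      have "c / r = 1 / F v \<or> c / r = 1 / G v"
        using ind[of "c / r"] that \<open>0 < r\<close> by (simp add: divide_inverse)
      then have "c = r / F v \<or> c = r / G v"
        using \<open>0 < r\<close> by (auto simp: field_simps)
      then show ?thesis
        using \<open>r \<le> F v\<close> \<open>r \<le> G v\<close> pos by auto
    qed
    ultimately show "0 < r \<and> v /\<^sub>R r \<in> outer_indicatrix F G"
      by (auto simp: outer_indicatrix_def)
  qed
  then show ?thesis
    using False by (simp add: radial_norm_def)
qed

text \<open>This turns restriction (II) into a comparison of the two norms in the direction of
  travel.\<close>

lemma velocity_in_outer_indicatrix_iff:
  assumes F: "minkowski_norm F" and G: "minkowski_norm G" and v: "v \<noteq> 0"
  defines "S \<equiv> outer_indicatrix F G"
  shows "velocity S v \<in> S \<inter> indicatrix F \<longleftrightarrow> F v \<le> G v"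
    and "velocity S v \<in> S \<inter> indicatrix G \<longleftrightarrow> G v \<le> F v"
proof -
  let ?r = "min (F v) (G v)"
  have pos: "0 < F v" "0 < G v"
    using minkowski_norm_pos[OF F v] minkowski_norm_pos[OF G v] by auto
  have vel: "velocity S v = (1 / ?r) *\<^sub>R v"
    by (simp add: velocity_def S_def radial_norm_outer_indicatrix[OF F G] inverse_eq_divide)
  have FG: "F (velocity S v) = F v / ?r" "G (velocity S v) = G v / ?r"
    unfolding vel using pos by (simp_all add: minkowski_norm_scale[OF F] minkowski_norm_scale[OF G])
  have "c \<le> 1" if "0 < c" "F (c *\<^sub>R velocity S v) = 1 \<or> G (c *\<^sub>R velocity S v) = 1" for c
  proof -
    have "c * F v / ?r = 1 \<or> c * G v / ?r = 1"
      using that FG by (simp add: minkowski_norm_scale[OF F] minkowski_norm_scale[OF G])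
    \<comment> \<open>For \<open>r = 0\<close> the premise fails because division by 0 yields 0, so
      \<open>r\<close> needs no sign here.\<close>
    moreover have "c = r / x" if "c * x / r = 1" "0 < x" for r x :: real
      using that by (cases "r = 0") (simp_all add: field_simps)
    ultimately have "c = ?r / F v \<or> c = ?r / G v"
      using pos by blast
    then show ?thesis using pos by auto
  qed
  moreover have "F (velocity S v) = 1 \<or> G (velocity S v) = 1"
    unfolding FG using pos by (simp add: min_def)
  ultimately have "velocity S v \<in> S"
    unfolding S_def outer_indicatrix_def indicatrix_def by blast
  then show "velocity S v \<in> S \<inter> indicatrix F \<longleftrightarrow> F v \<le> G v"
    and "velocity S v \<in> S \<inter> indicatrix G \<longleftrightarrow> G v \<le> F v"
    using pos FG by (auto simp: indicatrix_def min_def split: if_splits)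
qed

section \<open>Calibration\<close>

text \<open>Here \<open>u\<close> and \<open>w\<close> are the two legs, and moving the tack point
  by \<open>x\<close> turns them into \<open>u + x\<close> and \<open>w - x\<close>. The calibrating
  functional is the differential of \<open>G\<close> at \<open>w\<close>; subadditivity bounds it by
  \<open>G\<close>, optimality by \<open>F\<close>.\<close>

lemma calibration_aux:
  assumes F: "minkowski_norm F" and G: "minkowski_norm G" and w: "w \<noteq> 0"
    and opt: "\<And>x. F u + G w \<le> F (u + x) + G (w - x)"
  shows "\<exists>l. bounded_linear l \<and> (\<forall>x. l x \<le> F x \<and> l x \<le> G x) \<and> l (u + w) = F u + G w"
proof (intro exI conjI allI)
  let ?l = "frechet_derivative G (at w)"
  have diff: "G differentiable (at w)"
    by (rule minkowski_norm_differentiable[OF G w])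
  show l: "bounded_linear ?l"
    using diff by (auto simp: frechet_derivative_works has_derivative_def)
  show leG: "?l x \<le> G x" for x
  proof (rule frechet_derivative_le[OF diff])
    show "G (w + e *\<^sub>R x) \<le> G w + e * G x" if "0 < e" for e
      using minkowski_norm_add_le[OF G, of w "e *\<^sub>R x"] that
      by (simp add: minkowski_norm_scale[OF G])
  qed
  show leF: "?l x \<le> F x" for x
  proof -
    \<comment> \<open>Moving the tack point by \<open>e *\<^sub>R x\<close> costs at most
      \<open>e * F x\<close> on the first leg, and by optimality the second leg cannot save more
      than that.\<close>
    have "- F x \<le> ?l (- x)"
    proof (rule frechet_derivative_ge[OF diff])
      show "G w + e * - F x \<le> G (w + e *\<^sub>R - x)" if "0 < e" for e
        using opt[of "e *\<^sub>R x"] minkowski_norm_add_le[OF F, of u "e *\<^sub>R x"] that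
        by (simp add: minkowski_norm_scale[OF F])
    qed
    then show ?thesis
      by (simp add: linear_neg[OF bounded_linear.linear[OF l]])
  qed
  \<comment> \<open>Shortening the first leg by the fraction \<open>e\<close> saves
    \<open>e * F u\<close>, so the second leg must become dearer by at least this amount.\<close>
  have "F u \<le> ?l u"
  proof (rule frechet_derivative_ge[OF diff])
    fix e :: real assume e: "0 < e" "e < 1"
    have "u - e *\<^sub>R u = (1 - e) *\<^sub>R u"
      by (simp add: algebra_simps)
    then have "F (u - e *\<^sub>R u) = (1 - e) * F u"
      using e by (simp add: minkowski_norm_scale[OF F])
    then show "G w + e * F u \<le> G (w + e *\<^sub>R u)"
      using opt[of "- (e *\<^sub>R u)"] by (simp add: left_diff_distrib)
  qed
  \<comment> \<open>This is half of Euler's identity for a function homogeneous of degree 1; the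
    other half is \<open>leG\<close>.\<close>
  moreover have "G w \<le> ?l w"
  proof (rule frechet_derivative_ge[OF diff])
    fix e :: real assume e: "0 < e" "e < 1"
    have "w + e *\<^sub>R w = (1 + e) *\<^sub>R w"
      by (simp add: algebra_simps)
    then show "G w + e * G w \<le> G (w + e *\<^sub>R w)"
      using e by (simp add: minkowski_norm_scale[OF G] distrib_right)
  qed
  ultimately show "?l (u + w) = F u + G w"
    using leF[of u] leG[of w] by (simp add: linear_add[OF bounded_linear.linear[OF l]])
qed

text \<open>A differential is available only at a nonzero leg. If \<open>p = B\<close>, the first
  leg is nonzero because \<open>A \<noteq> B\<close>, and the argument is run with the two norms and
  the two legs exchanged.\<close>

lemma optimal_tack_point_calibration:
  assumes F: "minkowski_norm F" and G: "minkowski_norm G" and "A \<noteq> B"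
    and opt: "optimal_tack_point F G A B p"
  obtains l where "bounded_linear l" "\<And>x. l x \<le> F x" "\<And>x. l x \<le> G x"
    "l (B - A) = F (p - A) + G (B - p)"
proof (cases "p = B")
  case False
  have "F (p - A) + G (B - p) \<le> F (p - A + x) + G (B - p - x)" for x
    using opt[unfolded optimal_tack_point_def, rule_format, of "p + x"] by (simp add: algebra_simps)
  then obtain l where "bounded_linear l" "\<forall>x. l x \<le> F x \<and> l x \<le> G x"
    "l (p - A + (B - p)) = F (p - A) + G (B - p)"
    using calibration_aux[OF F G, of "B - p" "p - A"] False by auto
  then show ?thesis
    using that by simp
next
  case True
  have "G (B - p) + F (p - A) \<le> G (B - p + x) + F (p - A - x)" for x
    using opt[unfolded optimal_tack_point_def, rule_format, of "p - x"] by (simp add: algebra_simps)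
  then obtain l where "bounded_linear l" "\<forall>x. l x \<le> G x \<and> l x \<le> F x"
    "l (B - p + (p - A)) = G (B - p) + F (p - A)"
    using calibration_aux[OF G F, of "p - A" "B - p"] True \<open>A \<noteq> B\<close> by auto
  then show ?thesis
    using that by simp
qed

section \<open>Two optimal tack points\<close>

text \<open>Applied to the corresponding legs of two tack points, this expresses a leg through the
  vector joining the tack points.\<close>

lemma parallel_imp_multiple_diff:
  fixes u v :: "'a::real_vector"
  assumes "u = 0 \<or> (\<exists>c. v = c *\<^sub>R u)" "u \<noteq> v"
  shows "\<exists>a. u = a *\<^sub>R (v - u)"
proof (cases "u = 0")
  case True
  then show ?thesis by (auto intro: exI[of _ 0])
next
  case False
  then obtain c where c: "v = c *\<^sub>R u"
    using assms by blast
  then have "v - u = (c - 1) *\<^sub>R u" "c \<noteq> 1"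
    using assms by (auto simp: algebra_simps)
  then show ?thesis
    by (intro exI[of _ "1 / (c - 1)"]) simp
qed

text \<open>For \<open>s < 0\<close> the second leg alone is slower than tacking at
  \<open>A\<close>; for \<open>s > 1\<close> the first leg alone is slower than tacking at
  \<open>B\<close>.\<close>

lemma optimal_tack_point_on_line:
  assumes F: "minkowski_norm F" and G: "minkowski_norm G" and "A \<noteq> B"
    and opt: "optimal_tack_point F G A B (A + s *\<^sub>R (B - A))"
  shows "A + s *\<^sub>R (B - A) \<in> closed_segment A B"
proof -
  let ?v = "B - A"
  have pos: "0 < F ?v" "0 < G ?v"
    using minkowski_norm_pos[OF F] minkowski_norm_pos[OF G] \<open>A \<noteq> B\<close> by auto
  have B: "B - (A + s *\<^sub>R ?v) = (1 - s) *\<^sub>R ?v"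
    by (simp add: algebra_simps)
  have T: "F (s *\<^sub>R ?v) + G ((1 - s) *\<^sub>R ?v) \<le> G ?v" "F (s *\<^sub>R ?v) + G ((1 - s) *\<^sub>R ?v) \<le> F ?v"
    using opt[unfolded optimal_tack_point_def, rule_format, of A]
      opt[unfolded optimal_tack_point_def, rule_format, of B]
    unfolding B by (simp_all add: minkowski_norm_zero[OF F] minkowski_norm_zero[OF G])
  have "0 \<le> s"
  proof (rule ccontr)
    assume s: "\<not> 0 \<le> s"
    then have "(1 - s) * G ?v \<le> 1 * G ?v"
      using T(1) minkowski_norm_nonneg[OF F, of "s *\<^sub>R ?v"] by (simp add: minkowski_norm_scale[OF G])
    then show False
      using pos s by (simp only: mult_le_cancel_right) auto
  qed
  moreover have "s \<le> 1"
  proof (rule ccontr)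
    assume s: "\<not> s \<le> 1"
    then have "s * F ?v \<le> 1 * F ?v"
      using T(2) minkowski_norm_nonneg[OF G, of "(1 - s) *\<^sub>R ?v"]
      by (simp add: minkowski_norm_scale[OF F])
    then show False
      using pos s by (simp only: mult_le_cancel_right) auto
  qed
  ultimately show ?thesis
    by (auto simp: in_segment algebra_simps intro!: exI[of _ s])
qed

text \<open>By convexity the time at the midpoint is at most the common minimum, so both triangle
  inequalities are equalities. Corresponding legs are then parallel, and if
  \<open>p \<noteq> q\<close> both points lie on the line through \<open>A\<close> and
  \<open>B\<close>.\<close>

lemma optimal_tack_point_cases:
  assumes F: "minkowski_norm F" and G: "minkowski_norm G" and AB: "A \<noteq> B"
    and p: "optimal_tack_point F G A B p" and q: "optimal_tack_point F G A B q"
  shows "p = q \<or> p \<in> closed_segment A B \<and> q \<in> closed_segment A B"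
proof (cases "p = q")
  case False
  define d where "d = q - p"
  have eq: "F (p - A) + G (B - p) = F (q - A) + G (B - q)"
    using p q unfolding optimal_tack_point_def by (simp add: order_antisym)
  define m where "m = (1 / 2) *\<^sub>R p + (1 / 2) *\<^sub>R q"
  have "m - A = (1 / 2) *\<^sub>R ((p - A) + (q - A))" "B - m = (1 / 2) *\<^sub>R ((B - p) + (B - q))"
    unfolding m_def by (simp_all add: algebra_simps flip: scaleR_left_distrib)
  then have "F (m - A) + G (B - m) =
      (1 / 2) * (F ((p - A) + (q - A)) + G ((B - p) + (B - q)))"
    by (simp add: minkowski_norm_scale[OF F] minkowski_norm_scale[OF G])
  moreover have "F (p - A) + G (B - p) \<le> F (m - A) + G (B - m)"
    using p unfolding optimal_tack_point_def by blast
  ultimately have ge: "F (p - A) + F (q - A) + G (B - p) + G (B - q) \<le>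
      F ((p - A) + (q - A)) + G ((B - p) + (B - q))"
    using eq by simp
  have "p - A = 0 \<or> (\<exists>c. q - A = c *\<^sub>R (p - A))"
    using minkowski_norm_add_less[OF F, of "p - A" "q - A"]
      minkowski_norm_add_le[OF G, of "B - p" "B - q"] ge by force
  then obtain a where a: "p - A = a *\<^sub>R d"
    using parallel_imp_multiple_diff[of "p - A" "q - A"] False by (auto simp: d_def)
  \<comment> \<open>With \<open>B - q\<close> taken first, the difference of the two legs is
    \<open>d\<close> again rather than its negative.\<close>
  have "B - q = 0 \<or> (\<exists>c. B - p = c *\<^sub>R (B - q))"
    using minkowski_norm_add_less[OF G, of "B - q" "B - p"]
      minkowski_norm_add_le[OF F, of "p - A" "q - A"] ge by (force simp: add.commute)
  then obtain b where b: "B - q = b *\<^sub>R d"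
    using parallel_imp_multiple_diff[of "B - q" "B - p"] False by (auto simp: d_def)
  have "B - A = (p - A) + (q - p) + (B - q)"
    by simp
  also have "\<dots> = (a + 1 + b) *\<^sub>R d"
    unfolding a b by (simp add: d_def algebra_simps)
  finally have v: "B - A = (a + 1 + b) *\<^sub>R d" .
  \<comment> \<open>Since \<open>B - A\<close> is nonzero, the relation can be solved for
    \<open>d\<close>, which places \<open>p\<close> and \<open>q\<close> on the line through
    \<open>A\<close> and \<open>B\<close>.\<close>
  then have nz: "a + 1 + b \<noteq> 0"
    using AB by auto
  then have d: "d = (1 / (a + 1 + b)) *\<^sub>R (B - A)"
    unfolding v by simp
  have "p = A + (a / (a + 1 + b)) *\<^sub>R (B - A)"
    using a unfolding d by (simp add: algebra_simps)
  moreover have "q = A + ((a + 1) / (a + 1 + b)) *\<^sub>R (B - A)"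
  proof -
    have "q = A + (a + 1) *\<^sub>R d"
      using a by (simp add: d_def algebra_simps)
    then show ?thesis
      unfolding d by simp
  qed
  ultimately show ?thesis
    using optimal_tack_point_on_line[OF F G AB] p q by metis
qed simp

section \<open>Piecewise smooth curves\<close>

text \<open>The extension \<open>g\<close> has a derivative that is continuous up to the end points.
  That of \<open>\<gamma>\<close> agrees with it only in the interior, so the two end points are
  dropped from the integral. The function \<open>N\<close> is arbitrary: it stands for a norm, or
  for 0 where only the curve matters.\<close>

lemma regular_smooth_piece_imp:
  fixes \<gamma> :: "real \<Rightarrow> 'a::euclidean_space" and N :: "'a \<Rightarrow> real"
  assumes "regular_smooth_piece \<gamma> c d" and N: "continuous_on UNIV N"
  shows "continuous_on {c..d} \<gamma>"
    and "\<And>t. c < t \<Longrightarrow> t < d \<Longrightarrow> \<gamma> differentiable (at t)"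
    and "(\<lambda>t. N (vector_derivative \<gamma> (at t))) integrable_on {c..d}"
proof -
  obtain g U where U: "open U" "{c..d} \<subseteq> U" and g: "smooth_on U g"
    and eq: "\<And>t. t \<in> {c..d} \<Longrightarrow> \<gamma> t = g t"
    using assms(1) unfolding regular_smooth_piece_def by blast
  have "C_k_on (Suc 0) U g"
    using g unfolding smooth_on_def by blast
  then have diff: "\<And>t. t \<in> U \<Longrightarrow> g differentiable (at t)"
    and cont: "continuous_on U (\<lambda>x. frechet_derivative g (at x) 1)"
    by auto
  have fd: "frechet_derivative g (at x) 1 = vector_derivative g (at x)" if "x \<in> U" for x
    using diff[OF that] unfolding vector_derivative_works has_vector_derivative_def
    by (metis frechet_derivative_at scaleR_one)
  have "continuous_on {c..d} g"
    using diff U(2) by (intro continuous_at_imp_continuous_on ballI differentiable_imp_continuous_within) auto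
  then show "continuous_on {c..d} \<gamma>"
    using eq by (subst continuous_on_cong[OF refl, of _ \<gamma> g]) auto
  have der: "(\<gamma> has_vector_derivative vector_derivative g (at t)) (at t)" if "c < t" "t < d" for t
  proof (rule has_vector_derivative_transform_within_open[of g _ _ "{c<..<d}"])
    show "(g has_vector_derivative vector_derivative g (at t)) (at t)"
      using diff[OF subsetD[OF U(2), of t]] that vector_derivative_works by auto
  qed (use that eq in auto)
  then show "\<gamma> differentiable (at t)" if "c < t" "t < d" for t
    using that differentiableI_vector by blast
  have "continuous_on {c..d} (\<lambda>t. vector_derivative g (at t))"
    using continuous_on_subset[OF cont U(2)] fd U(2)
    by (subst continuous_on_cong[OF refl, of _ _ "\<lambda>x. frechet_derivative g (at x) 1"]) auto
  then have "continuous_on {c..d} (\<lambda>t. N (vector_derivative g (at t)))"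
    by (rule continuous_on_compose2[OF N]) auto
  then have "(\<lambda>t. N (vector_derivative g (at t))) integrable_on {c..d}"
    by (rule integrable_continuous_real)
  then show "(\<lambda>t. N (vector_derivative \<gamma> (at t))) integrable_on {c..d}"
    by (rule integrable_spike_finite[of "{c, d}", rotated 2])
      (use der vector_derivative_at in \<open>force simp: less_le\<close>)+
qed

lemma piecewise_smooth_curve_imp:
  fixes \<gamma> :: "real \<Rightarrow> 'a::euclidean_space" and N :: "'a \<Rightarrow> real"
  assumes "piecewise_smooth_curve \<gamma> a b" and N: "continuous_on UNIV N"
  shows "continuous_on {a..b} \<gamma>"
    and "\<exists>S. finite S \<and> (\<forall>t\<in>{a..b} - S. \<gamma> differentiable (at t))"
    and "(\<lambda>t. N (vector_derivative \<gamma> (at t))) integrable_on {a..b}"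
proof -
  obtain m :: nat and \<tau> where \<tau>: "\<tau> 0 = a" "\<tau> m = b"
    and piece: "\<And>i. i < m \<Longrightarrow> \<tau> i < \<tau> (Suc i) \<and> regular_smooth_piece \<gamma> (\<tau> i) (\<tau> (Suc i))"
    using assms(1) unfolding piecewise_smooth_curve_def by blast
  \<comment> \<open>Induction on the number of pieces; the break points accumulate in the finite
    exceptional set.\<close>
  have "a \<le> \<tau> k \<and> continuous_on {a..\<tau> k} \<gamma> \<and>
      (\<exists>S. finite S \<and> (\<forall>t\<in>{a..\<tau> k} - S. \<gamma> differentiable (at t))) \<and>
      (\<lambda>t. N (vector_derivative \<gamma> (at t))) integrable_on {a..\<tau> k}" if "k \<le> m" for k
    using that
  proof (induction k)
    case 0
    then show ?case
      using \<tau> integrable_on_refl[of _ a] by (auto intro!: exI[of _ "{a}"])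
  next
    case (Suc k)
    then obtain S where S: "finite S" "\<forall>t\<in>{a..\<tau> k} - S. \<gamma> differentiable (at t)"
      by auto
    have k: "\<tau> k < \<tau> (Suc k)" and r: "regular_smooth_piece \<gamma> (\<tau> k) (\<tau> (Suc k))"
      using piece Suc.prems by auto
    note p = regular_smooth_piece_imp[OF r N]
    have a: "a \<le> \<tau> k"
      using Suc by simp
    have un: "{a..\<tau> (Suc k)} = {a..\<tau> k} \<union> {\<tau> k..\<tau> (Suc k)}"
      using a k by auto
    have "continuous_on {a..\<tau> (Suc k)} \<gamma>"
      unfolding un using Suc p(1) by (intro continuous_on_closed_Un) auto
    moreover have "\<forall>t\<in>{a..\<tau> (Suc k)} - (S \<union> {\<tau> k, \<tau> (Suc k)}). \<gamma> differentiable (at t)"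
      using S p(2) by (metis Diff_iff UnI1 UnI2 atLeastAtMost_iff insertCI less_eq_real_def linorder_not_less)
    moreover have "finite (S \<union> {\<tau> k, \<tau> (Suc k)})"
      using S by simp
    moreover have "(\<lambda>t. N (vector_derivative \<gamma> (at t))) integrable_on {a..\<tau> (Suc k)}"
      by (rule Henstock_Kurzweil_Integration.integrable_combine[where c = "\<tau> k"])
        (use Suc p(3) a k in auto)
    ultimately show ?case
      using a k by (intro conjI exI[of _ "S \<union> {\<tau> k, \<tau> (Suc k)}"]) auto
  qed
  from this[of m] show "continuous_on {a..b} \<gamma>"
    and "\<exists>S. finite S \<and> (\<forall>t\<in>{a..b} - S. \<gamma> differentiable (at t))"
    and "(\<lambda>t. N (vector_derivative \<gamma> (at t))) integrable_on {a..b}"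
    using \<tau> by auto
qed

lemma piecewise_smooth_curve_continuous:
  "piecewise_smooth_curve \<gamma> a b \<Longrightarrow> continuous_on {a..b} \<gamma>"
  using piecewise_smooth_curve_imp(1)[of \<gamma> a b "\<lambda>_. 0"] by simp

section \<open>Line integrals of linear functionals and the lower bound for travel time\<close>

lemma has_integral_bounded_linear_derivative:
  fixes \<gamma> :: "real \<Rightarrow> 'a::euclidean_space" and l :: "'a \<Rightarrow> real"
  assumes \<gamma>: "piecewise_smooth_curve \<gamma> a b" and l: "bounded_linear l"
    and cd: "a \<le> c" "c \<le> d" "d \<le> b"
  shows "((\<lambda>t. l (vector_derivative \<gamma> (at t))) has_integral l (\<gamma> d - \<gamma> c)) {c..d}"
proof -
  obtain S where S: "finite S" "\<forall>t\<in>{a..b} - S. \<gamma> differentiable (at t)"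
    using piecewise_smooth_curve_imp(2)[OF \<gamma>, of "\<lambda>_. 0"] by auto
  have "continuous_on {c..d} \<gamma>"
    using piecewise_smooth_curve_continuous[OF \<gamma>] cd by (auto elim: continuous_on_subset)
  then have "((\<lambda>t. vector_derivative \<gamma> (at t)) has_integral \<gamma> d - \<gamma> c) {c..d}"
    using S cd
    by (intro fundamental_theorem_of_calculus_interior_strong[of S]) (auto simp flip: vector_derivative_works)
  from has_integral_linear[OF this l] show ?thesis
    by (simp add: o_def)
qed

lemma travel_time_ge:
  fixes \<gamma> :: "real \<Rightarrow> 'a::euclidean_space" and l :: "'a \<Rightarrow> real"
  assumes \<gamma>: "curve_from_to A B \<gamma> a b" and l: "bounded_linear l"
    and N: "continuous_on UNIV (radial_norm S)" and le: "\<And>x. l x \<le> radial_norm S x"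
  shows "l (B - A) \<le> travel_time S \<gamma> a b"
proof -
  have ps: "piecewise_smooth_curve \<gamma> a b" and "a \<le> b" "\<gamma> a = A" "\<gamma> b = B"
    using \<gamma> by (auto simp: curve_from_to_def piecewise_smooth_curve_def)
  then have "((\<lambda>t. l (vector_derivative \<gamma> (at t))) has_integral l (B - A)) {a..b}"
    using has_integral_bounded_linear_derivative[OF ps l, of a b] by simp
  then show ?thesis
    unfolding travel_time_def
    by (rule has_integral_le[OF _ integrable_integral[OF piecewise_smooth_curve_imp(3)[OF ps N]]])
      (simp add: le)
qed

section \<open>Straight segments\<close>

text \<open>A segment parameter is only required to be increasing. Projecting the curve onto the
  direction of the segment recovers it, so it inherits continuity.\<close>

lemma segment_parameter_continuous:
  fixes x y :: "'a::real_inner"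
  assumes "continuous_on I \<gamma>" "x \<noteq> y" "\<And>t. t \<in> I \<Longrightarrow> \<gamma> t = x + h t *\<^sub>R (y - x)"
  shows "continuous_on I h"
proof -
  have "h t = ((\<gamma> t - x) \<bullet> (y - x)) / ((y - x) \<bullet> (y - x))" if "t \<in> I" for t
    using assms that by simp
  then show ?thesis
    using assms(1,2) by (subst continuous_on_cong[OF refl]) (auto intro!: continuous_intros)
qed

text \<open>Along the segment the velocity is a nonnegative multiple of \<open>y - x\<close>, and on
  that ray \<open>N\<close> agrees with a linear functional, whose integral depends on the end
  points only.\<close>

lemma segment_time:
  fixes \<gamma> :: "real \<Rightarrow> 'a::euclidean_space" and N :: "'a \<Rightarrow> real"
  assumes \<gamma>: "piecewise_smooth_curve \<gamma> a b"
    and hom: "\<And>k v. 0 \<le> k \<Longrightarrow> N (k *\<^sub>R v) = k * N v"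
    and cd: "a \<le> c" "c \<le> d" "d \<le> b"
    and tr: "traverses_segment \<gamma> c d x y"
  shows "((\<lambda>t. N (vector_derivative \<gamma> (at t))) has_integral N (y - x)) {c..d}"
proof (cases "x = y")
  case True
  then have "c = d" and "N (y - x) = 0"
    using tr hom[of 0 0] by (auto simp: traverses_segment_def)
  then show ?thesis
    using has_integral_refl(2)[of _ c] by auto
next
  case False
  define v where "v = y - x"
  have v: "v \<noteq> 0" "v \<bullet> v \<noteq> 0"
    using False by (auto simp: v_def)
  obtain h where h: "strict_mono_on {c..d} h" "h c = 0" "h d = 1"
    and eq: "\<And>t. t \<in> {c..d} \<Longrightarrow> \<gamma> t = x + h t *\<^sub>R v" and "c < d"
    using tr False unfolding traverses_segment_def v_def by auto
  \<comment> \<open>The projection onto \<open>v\<close>, scaled so that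
    \<open>l v = N v\<close>.\<close>
  define l where "l = (\<lambda>z. z \<bullet> ((N v / (v \<bullet> v)) *\<^sub>R v))"
  have l: "bounded_linear l"
    unfolding l_def by (rule bounded_linear_inner_left)
  obtain S where S: "finite S" "\<forall>t\<in>{a..b} - S. \<gamma> differentiable (at t)"
    using piecewise_smooth_curve_imp(2)[OF \<gamma>, of "\<lambda>_. 0"] by auto
  have "N (vector_derivative \<gamma> (at t)) = l (vector_derivative \<gamma> (at t))"
    if t: "t \<in> {c..d} - (S \<union> {c, d})" for t
  proof -
    let ?D = "vector_derivative \<gamma> (at t)"
    \<comment> \<open>The candidate for the derivative of \<open>h\<close>, read off from the
      velocity by projection, since differentiability is known for \<open>\<gamma>\<close>
      only.\<close>
    define k where "k = ?D \<bullet> ((1 / (v \<bullet> v)) *\<^sub>R v)"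
    have "\<gamma> differentiable (at t)"
      using S t cd by auto
    then have "(\<gamma> has_vector_derivative ?D) (at t)"
      by (simp flip: vector_derivative_works)
    then have "((\<lambda>s. \<gamma> s - x) has_vector_derivative ?D) (at t)"
      by (auto intro!: derivative_eq_intros)
    then have "((\<lambda>s. (\<gamma> s - x) \<bullet> ((1 / (v \<bullet> v)) *\<^sub>R v)) has_vector_derivative k) (at t)"
      unfolding k_def by (rule bounded_linear.has_vector_derivative[OF bounded_linear_inner_left])
    then have hd: "(h has_vector_derivative k) (at t)"
      by (rule has_vector_derivative_transform_within_open[of _ _ _ "{c<..<d}"])
        (use t eq v in auto)
    then have "((\<lambda>s. x + h s *\<^sub>R v) has_vector_derivative k *\<^sub>R v) (at t)"
      by (auto intro!: derivative_eq_intros simp: has_real_derivative_iff_has_vector_derivative)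
    then have "(\<gamma> has_vector_derivative k *\<^sub>R v) (at t)"
      by (rule has_vector_derivative_transform_within_open[of _ _ _ "{c<..<d}"])
        (use t eq in auto)
    then have "?D = k *\<^sub>R v"
      by (rule vector_derivative_at)
    \<comment> \<open>Monotonicity gives \<open>0 \<le> k\<close>, the sign under which
      \<open>N\<close> is homogeneous.\<close>
    have "mono_on {c..d} h"
      using h(1) by (rule strict_mono_on_imp_mono_on)
    then have "mono_on {c<..<d} h"
      by (rule mono_on_subset) auto
    moreover have "(h has_real_derivative k) (at t)"
      using hd by (simp add: has_real_derivative_iff_has_vector_derivative)
    ultimately have "0 \<le> k"
      by (rule mono_on_imp_deriv_nonneg) (use t in auto)
    then show ?thesis
      using \<open>?D = k *\<^sub>R v\<close> v by (simp add: l_def hom)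
  qed
  moreover have "\<gamma> d - \<gamma> c = v"
    using eq[of c] eq[of d] h \<open>c < d\<close> by simp
  then have "((\<lambda>t. l (vector_derivative \<gamma> (at t))) has_integral N v) {c..d}"
    using has_integral_bounded_linear_derivative[OF \<gamma> l cd] v by (simp add: l_def)
  ultimately show ?thesis
    unfolding v_def[symmetric]
    by (rule has_integral_spike_finite[of "S \<union> {c, d}", rotated 1]) (use S in auto)
qed

lemma travel_time_two_segments:
  assumes \<gamma>: "piecewise_smooth_curve \<gamma> a b"
    and hom: "\<And>k v. 0 \<le> k \<Longrightarrow> radial_norm S (k *\<^sub>R v) = k * radial_norm S v"
    and c: "a \<le> c" "c \<le> b"
    and tr: "traverses_segment \<gamma> a c x y" "traverses_segment \<gamma> c b y z"
  shows "travel_time S \<gamma> a b = radial_norm S (y - x) + radial_norm S (z - y)"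
  unfolding travel_time_def
  by (rule integral_unique, rule has_integral_combine[OF c])
    (use c tr in \<open>auto intro!: segment_time[OF \<gamma> hom]\<close>)

section \<open>Reparametrization and concatenation of segments\<close>

lemma traverses_segment_reparametrization:
  fixes x y :: "'a::euclidean_space"
  assumes \<gamma>: "traverses_segment \<gamma> a b x y" "continuous_on {a..b} \<gamma>"
    and \<delta>: "traverses_segment \<delta> c d x y" "continuous_on {c..d} \<delta>"
  shows "reparametrization \<gamma> a b \<delta> c d"
proof (cases "x = y")
  case True
  then have "a = b" "c = d" "\<gamma> a = x" "\<delta> c = x"
    using \<gamma> \<delta> by (auto simp: traverses_segment_def)
  then show ?thesis
    unfolding reparametrization_def
    by (intro exI[of _ "\<lambda>_. c"]) (auto simp: strict_mono_on_def)
next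
  case False
  obtain h where h: "strict_mono_on {a..b} h" "h a = 0" "h b = 1" "a < b"
    and eqh: "\<And>t. t \<in> {a..b} \<Longrightarrow> \<gamma> t = x + h t *\<^sub>R (y - x)"
    using \<gamma>(1) False unfolding traverses_segment_def by auto
  obtain k where k: "strict_mono_on {c..d} k" "k c = 0" "k d = 1" "c < d"
    and eqk: "\<And>t. t \<in> {c..d} \<Longrightarrow> \<delta> t = x + k t *\<^sub>R (y - x)"
    using \<delta>(1) False unfolding traverses_segment_def by auto
  have ch: "continuous_on {a..b} h" and ck: "continuous_on {c..d} k"
    using segment_parameter_continuous[OF \<gamma>(2) False eqh]
      segment_parameter_continuous[OF \<delta>(2) False eqk] by auto
  have image: "f ` {u..v} = {0..1}"
    if "strict_mono_on {u..v} f" "f u = 0" "f v = 1" "u < v" "continuous_on {u..v} f"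
    for f :: "real \<Rightarrow> real" and u v
  proof
    have "0 \<le> f t \<and> f t \<le> 1" if "t \<in> {u..v}" for t
      using strict_mono_onD[OF \<open>strict_mono_on {u..v} f\<close>, of u t]
        strict_mono_onD[OF \<open>strict_mono_on {u..v} f\<close>, of t v] \<open>f u = 0\<close> \<open>f v = 1\<close> \<open>u < v\<close> that
      by (cases "t = u"; cases "t = v") auto
    then show "f ` {u..v} \<subseteq> {0..1}" by auto
    show "{0..1} \<subseteq> f ` {u..v}"
    proof
      fix s :: real assume "s \<in> {0..1}"
      then show "s \<in> f ` {u..v}"
        using IVT'[of f u s v] that by force
    qed
  qed
  have ih: "h ` {a..b} = {0..1}" and ik: "k ` {c..d} = {0..1}"
    using image h k ch ck by auto
  have inj: "inj_on k {c..d}"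
    using k(1) by (rule strict_mono_on_imp_inj_on)
  \<comment> \<open>Both \<open>h\<close> and \<open>k\<close> are increasing homeomorphisms onto
    \<open>{0..1}\<close>, so the inverse of \<open>k\<close> after \<open>h\<close> matches the two
    parametrizations.\<close>
  define j where "j = inv_into {c..d} k"
  have jin: "j s \<in> {c..d}" and kj: "k (j s) = s" if "s \<in> {0..1}" for s
    using that ik unfolding j_def by (auto intro: inv_into_into f_inv_into_f)
      (metis ik inv_into_into atLeastAtMost_iff)+
  have "continuous_on (k ` {c..d}) j"
    using ck inj by (intro continuous_on_inv) (auto simp: j_def inv_into_f_f)
  then have cj: "continuous_on {0..1} j"
    using ik by simp
  have mj: "strict_mono_on {0..1} j"
  proof (rule strict_mono_onI)
    fix r s :: real assume rs: "r \<in> {0..1}" "s \<in> {0..1}" "r < s"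
    show "j r < j s"
    proof (rule ccontr)
      assume "\<not> j r < j s"
      then have "k (j s) \<le> k (j r)"
        using mono_onD[OF strict_mono_on_imp_mono_on[OF k(1)]] jin rs by auto
      then show False using kj rs by auto
    qed
  qed
  have "j ` {0..1} = {c..d}"
    using inv_into_image_cancel[OF inj order_refl] unfolding ik j_def .
  moreover have hin: "h t \<in> {0..1}" if "t \<in> {a..b}" for t
    using that ih by blast
  ultimately show ?thesis
    unfolding reparametrization_def
  proof (intro exI[of _ "j \<circ> h"] conjI ballI)
    show "continuous_on {a..b} (j \<circ> h)"
      using ch cj ih by (intro continuous_on_compose) auto
    show "strict_mono_on {a..b} (j \<circ> h)"
      using strict_mono_onD[OF h(1)] strict_mono_onD[OF mj] hin by (intro strict_mono_onI) auto
    show "(j \<circ> h) ` {a..b} = {c..d}" if "j ` {0..1} = {c..d}"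
      using that ih by (metis image_comp)
    show "\<gamma> t = \<delta> ((j \<circ> h) t)" if "t \<in> {a..b}" for t
      using eqh[OF that] eqk[OF jin[OF hin[OF that]]] kj[OF hin[OF that]] by simp
  qed
qed

text \<open>An increasing surjection between intervals preserves end points, so both changes of
  parameter send \<open>c\<close> to \<open>c'\<close> and can be glued.\<close>

lemma reparametrization_concat:
  assumes "reparametrization \<gamma> a c \<delta> a' c'" "reparametrization \<gamma> c b \<delta> c' b'"
    and le: "a \<le> c" "c \<le> b" "a' \<le> c'" "c' \<le> b'"
  shows "reparametrization \<gamma> a b \<delta> a' b'"
proof -
  obtain f where f: "continuous_on {a..c} f" "strict_mono_on {a..c} f" "f ` {a..c} = {a'..c'}"
    "\<And>t. t \<in> {a..c} \<Longrightarrow> \<gamma> t = \<delta> (f t)"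
    using assms(1) unfolding reparametrization_def by blast
  obtain g where g: "continuous_on {c..b} g" "strict_mono_on {c..b} g" "g ` {c..b} = {c'..b'}"
    "\<And>t. t \<in> {c..b} \<Longrightarrow> \<gamma> t = \<delta> (g t)"
    using assms(2) unfolding reparametrization_def by blast
  have "f c = c'"
  proof (rule order_antisym)
    show "f c \<le> c'" using f(3) le by (metis atLeastAtMost_iff imageI order_refl)
    obtain t where "t \<in> {a..c}" "f t = c'" using f(3) le by (metis atLeastAtMost_iff imageE order_refl)
    then show "c' \<le> f c"
      using mono_onD[OF strict_mono_on_imp_mono_on[OF f(2)], of t c] le by auto
  qed
  moreover have "g c = c'"
  proof (rule order_antisym)
    show "c' \<le> g c" using g(3) le by (metis atLeastAtMost_iff imageI order_refl)
    obtain t where "t \<in> {c..b}" "g t = c'" using g(3) le by (metis atLeastAtMost_iff imageE order_refl)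
    then show "g c \<le> c'"
      using mono_onD[OF strict_mono_on_imp_mono_on[OF g(2)], of c t] le by auto
  qed
  ultimately have fg: "f c = g c" by simp
  define h where "h = (\<lambda>t. if t \<le> c then f t else g t)"
  have hf: "h t = f t" if "t \<in> {a..c}" for t
    using that by (simp add: h_def)
  have hg: "h t = g t" if "t \<in> {c..b}" for t
    using that fg by (auto simp: h_def)
  have un: "{a..b} = {a..c} \<union> {c..b}" "{a'..b'} = {a'..c'} \<union> {c'..b'}"
    using le by auto
  show ?thesis
    unfolding reparametrization_def
  proof (intro exI[of _ h] conjI ballI)
    show "continuous_on {a..b} h"
      unfolding un
    proof (rule continuous_on_closed_Un)
      show "continuous_on {a..c} h"
        using f(1) hf continuous_on_cong[OF refl, of "{a..c}" h f] by blast
      show "continuous_on {c..b} h"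
        using g(1) hg continuous_on_cong[OF refl, of "{c..b}" h g] by blast
    qed auto
    have "h ` {a..c} = {a'..c'}" "h ` {c..b} = {c'..b'}"
      using f(3) g(3) hf hg by (metis image_cong)+
    then show "h ` {a..b} = {a'..b'}"
      unfolding un image_Un by simp
    show "\<gamma> t = \<delta> (h t)" if "t \<in> {a..b}" for t
      using that f(4) g(4) hf hg unfolding un by auto
    show "strict_mono_on {a..b} h"
    proof (rule strict_mono_onI)
      fix s t assume st: "s \<in> {a..b}" "t \<in> {a..b}" "s < t"
      consider "t \<le> c" | "c \<le> s" | "s < c" "c < t" by linarith
      then show "h s < h t"
      proof cases
        case 1
        then show ?thesis using st strict_mono_onD[OF f(2), of s t] hf by auto
      next
        case 2
        then show ?thesis using st strict_mono_onD[OF g(2), of s t] hg by auto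
      next
        case 3
        then show ?thesis
          using st strict_mono_onD[OF f(2), of s c] strict_mono_onD[OF g(2), of c t] fg
          by (auto simp: h_def)
      qed
    qed
  qed
qed

lemma traverses_segment_concat:
  fixes x y z :: "'a::euclidean_space"
  assumes "traverses_segment \<gamma> a c x y" and "traverses_segment \<gamma> c b y z"
    and y: "y \<in> closed_segment x z" and xz: "x \<noteq> z"
  shows "traverses_segment \<gamma> a b x z"
proof -
  consider "y = x" | "y = z" | "y \<noteq> x" "y \<noteq> z" by blast
  then show ?thesis
  proof cases
    case 1
    with assms(1,2) show ?thesis by (auto simp: traverses_segment_def)
  next
    case 2
    with assms(1,2) show ?thesis by (auto simp: traverses_segment_def)
  next
    case 3
    obtain s where s: "0 \<le> s" "s \<le> 1" "y = x + s *\<^sub>R (z - x)"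
      using y by (auto simp: in_segment algebra_simps)
    then have "s \<noteq> 0" "s \<noteq> 1"
      using 3 by auto
    with s have s01: "0 < s" "s < 1" by auto
    obtain h where h: "strict_mono_on {a..c} h" "h a = 0" "h c = 1" "a < c"
      and eqh: "\<And>t. t \<in> {a..c} \<Longrightarrow> \<gamma> t = x + h t *\<^sub>R (y - x)"
      using assms(1) 3 unfolding traverses_segment_def by auto
    obtain k where k: "strict_mono_on {c..b} k" "k c = 0" "k b = 1" "c < b"
      and eqk: "\<And>t. t \<in> {c..b} \<Longrightarrow> \<gamma> t = y + k t *\<^sub>R (z - y)"
      using assms(2) 3 unfolding traverses_segment_def by auto
    \<comment> \<open>The first leg covers the fraction \<open>s\<close> of the whole segment. The
      two formulas agree at \<open>c\<close>, since \<open>h c = 1\<close> and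
      \<open>k c = 0\<close>.\<close>
    define j where "j = (\<lambda>t. if t \<le> c then s * h t else s + (1 - s) * k t)"
    have jk: "j t = s + (1 - s) * k t" if "c \<le> t" for t
      using that h k by (auto simp: j_def)
    have "strict_mono_on {a..b} j"
    proof (rule strict_mono_onI)
      fix r t assume rt: "r \<in> {a..b}" "t \<in> {a..b}" "r < t"
      consider "t \<le> c" | "c \<le> r" | "r < c" "c < t" by linarith
      then show "j r < j t"
      proof cases
        case 1
        then show ?thesis using rt strict_mono_onD[OF h(1), of r t] s01 by (auto simp: j_def)
      next
        case 2
        then show ?thesis using rt strict_mono_onD[OF k(1), of r t] jk s01 by auto
      next
        case 3
        have "s * h r < s * 1" "0 < (1 - s) * k t"
          using 3 rt strict_mono_onD[OF h(1), of r c] strict_mono_onD[OF k(1), of c t] h k s01 by auto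
        then show ?thesis
          using 3 by (simp add: j_def)
      qed
    qed
    moreover have "\<gamma> t = x + j t *\<^sub>R (z - x)" if "t \<in> {a..b}" for t
    proof (cases "t \<le> c")
      case True
      then show ?thesis
        using eqh[of t] that s(3) by (simp add: j_def mult.commute)
    next
      case False
      have "z - y = (1 - s) *\<^sub>R (z - x)"
        unfolding s(3) by (simp add: algebra_simps)
      then show ?thesis
        using eqk[of t] that False s(3) by (simp add: j_def algebra_simps)
    qed
    moreover have "j a = 0" "j b = 1"
      using h k by (auto simp: j_def)
    ultimately show ?thesis
      using xz h k unfolding traverses_segment_def by auto
  qed
qed

section \<open>The broken line as a regular curve\<close>

lemma smooth_on_affine:
  fixes x v :: "'a::real_normed_vector"
  shows "smooth_on S (\<lambda>t::real. x + t *\<^sub>R v)"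
proof -
  have const: "C_k_on k S (\<lambda>_::real. c)" for k and c :: 'a
    by (induction k arbitrary: c) auto
  have "((\<lambda>t. x + t *\<^sub>R v) has_derivative (\<lambda>h. h *\<^sub>R v)) (at t)" for t :: real
    by (auto intro!: derivative_eq_intros)
  then have "frechet_derivative (\<lambda>t. x + t *\<^sub>R v) (at t) = (\<lambda>h. h *\<^sub>R v)" for t :: real
    by (metis frechet_derivative_at)
  then have "C_k_on k S (\<lambda>t::real. x + t *\<^sub>R v)" for k
    using const by (cases k) (auto intro!: continuous_intros derivative_intros)
  then show ?thesis
    by (simp add: smooth_on_def)
qed

lemma regular_smooth_piece_affine:
  assumes "v \<noteq> 0" "\<And>t. t \<in> {c..d} \<Longrightarrow> \<gamma> t = x + t *\<^sub>R v"
  shows "regular_smooth_piece \<gamma> c d"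
proof -
  have "((\<lambda>t. x + t *\<^sub>R v) has_vector_derivative v) (at t)" for t
    by (auto intro!: derivative_eq_intros)
  then have "vector_derivative (\<lambda>t. x + t *\<^sub>R v) (at t) = v" for t
    by (rule vector_derivative_at)
  then show ?thesis
    unfolding regular_smooth_piece_def using assms smooth_on_affine[of UNIV x v]
    by (intro exI[of _ "\<lambda>t. x + t *\<^sub>R v"] exI[of _ UNIV]) auto
qed

lemma affine_piece:
  assumes "c < d" "x \<noteq> y" "\<And>t. t \<in> {c..d} \<Longrightarrow> \<gamma> t = x + ((t - c) / (d - c)) *\<^sub>R (y - x)"
  shows "regular_smooth_piece \<gamma> c d" "traverses_segment \<gamma> c d x y"
proof -
  show "regular_smooth_piece \<gamma> c d"
    using assms
    \<comment> \<open>The base point is shifted back to parameter 0, which makes the piece affine in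
      \<open>t\<close> itself.\<close>
    by (intro regular_smooth_piece_affine[of "(1 / (d - c)) *\<^sub>R (y - x)" _ _ _
          "x - (c / (d - c)) *\<^sub>R (y - x)"])
      (auto simp: diff_divide_distrib scaleR_left_diff_distrib)
  show "traverses_segment \<gamma> c d x y"
    unfolding traverses_segment_def using assms
    by (auto intro!: exI[of _ "\<lambda>t. (t - c) / (d - c)"] strict_mono_onI divide_strict_right_mono)
qed

lemma piecewise_segment_traverses:
  fixes A B p :: "'a::euclidean_space"
  assumes "A \<noteq> B"
  obtains c where "0 \<le> c" "c \<le> 1" "traverses_segment (piecewise_segment A p B) 0 c A p"
    "traverses_segment (piecewise_segment A p B) c 1 p B"
    "curve_from_to A B (piecewise_segment A p B) 0 1"
proof (cases "p = A \<or> p = B")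
  case True
  let ?\<gamma> = "piecewise_segment A p B"
  have eq: "?\<gamma> t = A + ((t - 0) / (1 - 0)) *\<^sub>R (B - A)" for t
    using True by (auto simp: piecewise_segment_def linepath_def algebra_simps)
  have r: "regular_smooth_piece ?\<gamma> 0 1" and t: "traverses_segment ?\<gamma> 0 1 A B"
    using affine_piece[OF zero_less_one assms, of ?\<gamma>] eq by auto
  have "curve_from_to A B ?\<gamma> 0 1"
    unfolding curve_from_to_def piecewise_smooth_curve_def
    using r eq[of 0] eq[of 1] by (auto intro!: exI[of _ "Suc 0"] exI[of _ real])
  moreover have "traverses_segment ?\<gamma> 0 0 A A" "traverses_segment ?\<gamma> 1 1 B B"
    using eq[of 0] eq[of 1] by (auto simp: traverses_segment_def)
  ultimately show ?thesis
    \<comment> \<open>The degenerate leg occupies one parameter value: 0 if \<open>p = A\<close>, 1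
      if \<open>p = B\<close>.\<close>
    using that[of 0] that[of 1] t True by auto
next
  case False
  let ?\<gamma> = "piecewise_segment A p B"
  have eq: "?\<gamma> t = (if t \<le> 1/2 then A + (2 * t) *\<^sub>R (p - A) else p + (2 * t - 1) *\<^sub>R (B - p))" for t
    using False by (auto simp: piecewise_segment_def linepath_def joinpaths_def algebra_simps)
  have 1: "regular_smooth_piece ?\<gamma> 0 (1/2)" "traverses_segment ?\<gamma> 0 (1/2) A p"
    using False by (auto intro!: affine_piece[of 0 "1/2" A p] simp: eq mult.commute)
  have "?\<gamma> t = p + ((t - 1/2) / (1 - 1/2)) *\<^sub>R (B - p)" if "t \<in> {1/2..1}" for t
  proof -
    \<comment> \<open>At \<open>t = 1/2\<close> the first branch of \<open>eq\<close> is the active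
      one; both branches give \<open>p\<close> there, so the second formula holds on the closed
      interval.\<close>
    have "2 * t = 1 \<or> \<not> t \<le> 1/2"
      using that by auto
    moreover have "(t - 1/2) / (1 - 1/2) = 2 * t - 1"
      by simp
    ultimately show ?thesis
      by (elim disjE) (simp_all add: eq)
  qed
  then have 2: "regular_smooth_piece ?\<gamma> (1/2) 1" "traverses_segment ?\<gamma> (1/2) 1 p B"
    using False by (auto intro!: affine_piece[of "1/2" 1 p B])
  have "piecewise_smooth_curve ?\<gamma> 0 1"
    unfolding piecewise_smooth_curve_def
    using 1(1) 2(1)
    by (auto intro!: exI[of _ "Suc (Suc 0)"] exI[of _ "\<lambda>i. real i / 2"] simp: less_Suc_eq)
  then have "curve_from_to A B ?\<gamma> 0 1"
    by (simp add: curve_from_to_def eq)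
  then show ?thesis
    using that[of "1/2"] 1 2 by simp
qed

section \<open>Minimality of the broken line and uniqueness up to reparametrization\<close>

theorem theorem5p6:
  fixes F\<alpha> F\<beta> :: "real ^ 'n \<Rightarrow> real" and A B p :: "real ^ 'n" and \<Sigma> :: "(real ^ 'n) set"
  assumes "CARD('n) \<ge> 2"
    and "minkowski_norm F\<alpha>" and "minkowski_norm F\<beta>"
    and "A \<noteq> B"
    and "optimal_tack_point F\<alpha> F\<beta> A B p"
    and "\<Sigma> = outer_indicatrix F\<alpha> F\<beta>"
    and "multi_convex {F\<alpha>, F\<beta>} \<Sigma>"
  shows "time_minimizing \<Sigma> A B (piecewise_segment A p B) 0 1 \<and>
    single_tack_curve \<Sigma> F\<alpha> F\<beta> A B (piecewise_segment A p B) 0 1 \<and>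
    (\<forall>\<gamma> a b. time_minimizing \<Sigma> A B \<gamma> a b \<and> single_tack_curve \<Sigma> F\<alpha> F\<beta> A B \<gamma> a b \<longrightarrow>
       reparametrization \<gamma> a b (piecewise_segment A p B) 0 1)"
proof -
  note F = assms(2) and G = assms(3) and AB = assms(4) and opt = assms(5)
  let ?N = "radial_norm \<Sigma>" and ?\<sigma> = "piecewise_segment A p B"
  have N: "?N = (\<lambda>v. min (F\<alpha> v) (F\<beta> v))"
    unfolding assms(6) by (rule ext) (rule radial_norm_outer_indicatrix[OF F G])
  have contN: "continuous_on UNIV ?N"
    unfolding N by (intro continuous_intros minkowski_norm_continuous F G)
  have hom: "?N (k *\<^sub>R v) = k * ?N v" if "0 \<le> k" for k v
    unfolding N using that
    by (simp add: minkowski_norm_scale[OF F] minkowski_norm_scale[OF G] min_mult_distrib_left)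
  note vel = velocity_in_outer_indicatrix_iff[OF F G, folded assms(6)]
  obtain l where l: "bounded_linear l" "\<And>x. l x \<le> F\<alpha> x" "\<And>x. l x \<le> F\<beta> x"
    "l (B - A) = F\<alpha> (p - A) + F\<beta> (B - p)"
    using optimal_tack_point_calibration[OF F G AB opt] by blast
  have lN: "l x \<le> ?N x" for x
    unfolding N using l by simp
  obtain c where c: "0 \<le> c" "c \<le> 1" and tr: "traverses_segment ?\<sigma> 0 c A p"
    "traverses_segment ?\<sigma> c 1 p B" and \<sigma>: "curve_from_to A B ?\<sigma> 0 1"
    using piecewise_segment_traverses[OF AB, of p] by blast
  have ps: "piecewise_smooth_curve ?\<sigma> 0 1"
    using \<sigma> by (simp add: curve_from_to_def)
  have time: "travel_time \<Sigma> ?\<sigma> 0 1 = ?N (p - A) + ?N (B - p)"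
    by (rule travel_time_two_segments[OF ps hom c tr])
  have "l (B - A) = l (p - A) + l (B - p)"
    using linear_add[OF bounded_linear.linear[OF l(1)], of "p - A" "B - p"] by simp
  \<comment> \<open>On each leg \<open>l\<close> is at most \<open>?N\<close>, which is at most the
    norm of that leg, while the outer terms have equal sums over the two legs. Equality therefore
    holds throughout, which gives both the minimal time and restriction (II).\<close>
  then have Np: "?N (p - A) = F\<alpha> (p - A)" "?N (B - p) = F\<beta> (B - p)"
    using l(4) lN[of "p - A"] lN[of "B - p"] unfolding N by linarith+
  have "time_minimizing \<Sigma> A B ?\<sigma> 0 1"
    unfolding time_minimizing_def
    using \<sigma> travel_time_ge[OF _ l(1) contN lN, of A B] time Np l(4) by simp
  moreover have "single_tack_curve \<Sigma> F\<alpha> F\<beta> A B ?\<sigma> 0 1"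
    unfolding single_tack_curve_def
  proof (intro exI[of _ p] exI[of _ c] conjI impI)
    show "velocity \<Sigma> (p - A) \<in> \<Sigma> \<inter> indicatrix F\<alpha>" if "p \<noteq> A"
      using vel(1)[of "p - A"] Np(1) that unfolding N by (simp add: min_def split: if_splits)
    show "velocity \<Sigma> (B - p) \<in> \<Sigma> \<inter> indicatrix F\<beta>" if "p \<noteq> B"
      using vel(2)[of "B - p"] Np(2) that unfolding N by (simp add: min_def split: if_splits)
  qed (use c tr in auto)
  moreover have "reparametrization \<gamma> a b ?\<sigma> 0 1"
    if \<gamma>: "time_minimizing \<Sigma> A B \<gamma> a b" "single_tack_curve \<Sigma> F\<alpha> F\<beta> A B \<gamma> a b" for \<gamma> a b
  proof -
    obtain q e where e: "a \<le> e" "e \<le> b"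
      and tr': "traverses_segment \<gamma> a e A q" "traverses_segment \<gamma> e b q B"
      and vF: "q \<noteq> A \<longrightarrow> velocity \<Sigma> (q - A) \<in> \<Sigma> \<inter> indicatrix F\<alpha>"
      and vG: "q \<noteq> B \<longrightarrow> velocity \<Sigma> (B - q) \<in> \<Sigma> \<inter> indicatrix F\<beta>"
      using \<gamma>(2) unfolding single_tack_curve_def by blast
    have ps': "piecewise_smooth_curve \<gamma> a b"
      using \<gamma>(1) by (simp add: time_minimizing_def curve_from_to_def)
    \<comment> \<open>Restriction (II) makes the norm of each leg the smaller one there; on a
      degenerate leg both norms vanish. The travel time of \<open>\<gamma>\<close> is thus the
      tacking time at \<open>q\<close>.\<close>
    have "?N (q - A) = F\<alpha> (q - A)"
      using vel(1)[of "q - A"] vF unfolding N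
      by (cases "q = A") (auto simp: minkowski_norm_zero[OF F] minkowski_norm_zero[OF G])
    moreover have "?N (B - q) = F\<beta> (B - q)"
      using vel(2)[of "B - q"] vG unfolding N
      by (cases "q = B") (auto simp: minkowski_norm_zero[OF F] minkowski_norm_zero[OF G])
    moreover have "travel_time \<Sigma> \<gamma> a b = ?N (q - A) + ?N (B - q)"
      by (rule travel_time_two_segments[OF ps' hom e tr'])
    moreover have "travel_time \<Sigma> \<gamma> a b \<le> travel_time \<Sigma> ?\<sigma> 0 1"
      using \<gamma>(1) \<sigma> unfolding time_minimizing_def by blast
    ultimately have "F\<alpha> (q - A) + F\<beta> (B - q) \<le> F\<alpha> (p - A) + F\<beta> (B - p)"
      using time Np by simp
    then have opt': "optimal_tack_point F\<alpha> F\<beta> A B q"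
      using opt unfolding optimal_tack_point_def by (meson order_trans)
    have cont: "continuous_on {a..b} \<gamma>" "continuous_on {0..1} ?\<sigma>"
      using ps ps' piecewise_smooth_curve_continuous by auto
    from optimal_tack_point_cases[OF F G AB opt opt'] show ?thesis
    proof
      assume "p = q"
      then have "reparametrization \<gamma> a e ?\<sigma> 0 c" "reparametrization \<gamma> e b ?\<sigma> c 1"
        using tr tr' cont c e
        by (auto intro!: traverses_segment_reparametrization elim!: continuous_on_subset)
      then show ?thesis
        using e c by (rule reparametrization_concat)
    next
      \<comment> \<open>The tack points may differ here, but both curves run once along the straight
        segment from \<open>A\<close> to \<open>B\<close>.\<close>
      assume "p \<in> closed_segment A B \<and> q \<in> closed_segment A B"
      then have "traverses_segment \<gamma> a b A B" "traverses_segment ?\<sigma> 0 1 A B"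
        using traverses_segment_concat tr tr' AB by blast+
      then show ?thesis
        using cont by (intro traverses_segment_reparametrization)
    qed
  qed
  ultimately show ?thesis
    by blast
qed

end
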